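(* Let $m\ge 0$ be an integer. For every $l\in\{0,1,\ldots,m\}$ the polynomials $\mathcal{H}_l^m$ and $\mathcal{I}_l^m$ satisfy the Hermite spline continuity conditions $$(\mathcal{H}_l^m)^{(k)}(1)=(\mathcal{I}_l^m)^{(k)}(0)=0,\qquad k=0,1,\ldots,m,$$ $$(\mathcal{H}_l^m)^{(k)}(0)=(\mathcal{I}_l^m)^{(k)}(1)=\begin{cases}1 & k=l,\\ 0 & k\ne l,\end{cases}\qquad k=0,1,\ldots,m.$$
   Context: For integers $m\ge 0$ and $0\le l\le m$, and $\xi\in[0,1]$, define the polynomials of degree $2m+1$ $$\mathcal{H}_l^m(\xi)=\frac{(1-\xi)^{m+1}\xi^l}{l!}\sum_{n=0}^{m-l}S_n^m\,\xi^n,\qquad \mathcal{I}_l^m(\xi)=(-1)^l\mathcal{H}_l^m(1-\xi),\qquad S_n^m=\frac{(m+n)!}{m!\,n!}.$$ The superscript $(k)$ denotes the $k$-th derivative with respect to $\xi$. *)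

theory Defs
  imports "HOL-Analysis.Analysis" "HOL-Computational_Algebra.Polynomial"
begin

definition S_coeff :: "nat \<Rightarrow> nat \<Rightarrow> real" where
  "S_coeff m n = fact (m + n) / (fact m * fact n)"

text \<open>The factor \<open>[:1, -1:]\<close> is the polynomial \<open>1 - \<xi>\<close>, and \<open>monom c n\<close> is \<open>c * \<xi> ^ n\<close>.
  The upper summation bound \<open>m - l\<close> is truncated subtraction, so the definition is meant
  for \<open>l \<le> m\<close> only.\<close>

definition hermite_H :: "nat \<Rightarrow> nat \<Rightarrow> real poly" where
  "hermite_H m l =
     smult (1 / fact l)
       ([:1, -1:] ^ (m + 1) * monom 1 l * (\<Sum>n = 0..m - l. monom (S_coeff m n) n))"

definition hermite_I :: "nat \<Rightarrow> nat \<Rightarrow> real poly" where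
  "hermite_I m l = smult ((- 1) ^ l) (pcompose (hermite_H m l) [:1, -1:])"

lemma poly_hermite_H:
  "poly (hermite_H m l) \<xi> =
     (1 - \<xi>) ^ (m + 1) * \<xi> ^ l / fact l * (\<Sum>n = 0..m - l. S_coeff m n * \<xi> ^ n)"
  by (simp add: hermite_H_def poly_monom poly_sum poly_power del: power_Suc)

lemma poly_hermite_I:
  "poly (hermite_I m l) \<xi> = (- 1) ^ l * poly (hermite_H m l) (1 - \<xi>)"
  by (simp add: hermite_I_def poly_pcompose)

text \<open>The iterated formal derivative is the iterated analytic derivative of the polynomial
  function.\<close>

lemma higher_deriv_poly:
  "(deriv ^^ k) (poly p) = poly ((pderiv ^^ k) (p :: real poly))"
proof (induction k)
  case (Suc k)
  have "deriv (poly q) = poly (pderiv q)" for q :: "real poly"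
    by (rule ext) (rule DERIV_imp_deriv, rule poly_DERIV)
  with Suc show ?case by simp
qed simp

end

theory Submission
  imports Defs
begin

text \<open>
  The polynomial \<open>\<Sum>n\<le>N. S_coeff m n \<xi>^n\<close> is the Taylor section of \<open>(1 - \<xi>)^-(m+1)\<close>,
  so its product with \<open>(1 - \<xi>)^(m+1)\<close> is \<open>1\<close> modulo \<open>\<xi>^(N+1)\<close>.
  For \<open>N = m - l\<close> this gives \<open>hermite_H m l = \<xi>^l / l!\<close> modulo \<open>\<xi>^(m+1)\<close>, which fixes the
  derivatives at \<open>0\<close>; those at \<open>1\<close> vanish because of the factor \<open>(1 - \<xi>)^(m+1)\<close>. The chain rule
  transfers both facts to \<open>hermite_I\<close>.
\<close>

lemma S_coeff_binomial: "S_coeff m n = of_nat ((m + n) choose m)"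
  by (simp add: S_coeff_def binomial_fact)

lemma S_coeff_0_left [simp]: "S_coeff 0 n = 1"
  by (simp add: S_coeff_def)

lemma S_coeff_Suc_Suc: "S_coeff (Suc m) (Suc n) = S_coeff m (Suc n) + S_coeff (Suc m) n"
  by (simp add: S_coeff_binomial)

text \<open>Truncation of \<open>(1 - \<xi>) * (1 - \<xi>)^-(m+2) = (1 - \<xi>)^-(m+1)\<close>:
  Pascal's rule cancels all but the boundary term at degree \<open>N + 1\<close>.\<close>

lemma one_minus_times_S_section:
  "[:1, -1:] * (\<Sum>n\<le>N. monom (S_coeff (Suc m) n) n) =
     (\<Sum>n\<le>N. monom (S_coeff m n) n) - monom (S_coeff (Suc m) N) (Suc N)"
proof (induction N)
  case 0
  show ?case by (simp add: S_coeff_binomial monom_Suc monom_0)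
next
  case (Suc N)
  have shift: "[:1, -1:] * monom c n = monom c n - monom c (Suc n)" for c :: real and n
    by (simp add: monom_Suc)
  show ?case
    by (simp only: sum.atMost_Suc distrib_left Suc.IH shift S_coeff_Suc_Suc [of m N])
       (simp add: add_monom [symmetric])
qed

lemma S_section_inverse_mod:
  "monom 1 (Suc N) dvd [:1, -1:] ^ Suc m * (\<Sum>n\<le>N. monom (S_coeff m n) n) - 1"
proof (induction m)
  case 0
  \<comment> \<open>The finite geometric sum.\<close>
  have "[:1, -1:] * (\<Sum>n\<le>N. monom (S_coeff 0 n) n) = 1 - monom 1 (Suc N)"
    by (induction N) (simp_all add: distrib_left monom_Suc monom_0 one_pCons)
  then show ?case by simp
next
  case (Suc m)
  have "[:1, -1:] ^ Suc (Suc m) * (\<Sum>n\<le>N. monom (S_coeff (Suc m) n) n) - 1 =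
      [:1, -1:] ^ Suc m * ([:1, -1:] * (\<Sum>n\<le>N. monom (S_coeff (Suc m) n) n)) - 1"
    by (simp only: power_Suc2 [of _ "Suc m"] mult.assoc)
  also have "\<dots> = ([:1, -1:] ^ Suc m * (\<Sum>n\<le>N. monom (S_coeff m n) n) - 1)
      - [:1, -1:] ^ Suc m * monom (S_coeff (Suc m) N) (Suc N)"
    by (simp only: one_minus_times_S_section right_diff_distrib diff_right_commute)
  finally show ?case
    by (simp only:) (intro dvd_diff dvd_mult Suc.IH, simp add: monom_1_dvd_iff')
qed

lemma coeff_hermite_H:
  assumes "l \<le> m" "k \<le> m"
  shows "coeff (hermite_H m l) k = (if k = l then 1 / fact l else 0)"
proof -
  obtain r where "[:1, -1:] ^ Suc m * (\<Sum>n\<le>m - l. monom (S_coeff m n) n) - 1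
      = monom 1 (Suc (m - l)) * r"
    by (rule dvdE [OF S_section_inverse_mod])
  then have "hermite_H m l = smult (1 / fact l) (monom 1 l * (1 + monom 1 (Suc (m - l)) * r))"
    by (simp only: hermite_H_def atMost_atLeast0 diff_eq_eq mult.assoc
        mult.left_commute [of _ "monom 1 l"] Suc_eq_plus1) (simp only: add.commute)
  \<comment> \<open>The degrees add up to \<open>l + Suc (m - l) = Suc m\<close> because
    \<open>l \<le> m\<close>, so the remainder misses every coefficient up to
    \<open>m\<close>.\<close>
  also have "\<dots> = smult (1 / fact l) (monom 1 l + monom 1 (Suc m) * r)"
    using assms(1) by (simp add: distrib_left mult_monom mult.assoc [symmetric])
  finally show ?thesis
    using assms(2) by (auto simp: coeff_monom_mult)
qed

text \<open>By the product rule, each derivative costs at most one factor \<open>q\<close>.\<close>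

lemma power_dvd_higher_pderiv:
  fixes p q :: "'a::idom poly"
  assumes "q ^ (n + k) dvd p"
  shows "q ^ n dvd (pderiv ^^ k) p"
  using assms
proof (induction k arbitrary: n)
  case (Suc k)
  have "q ^ Suc n dvd (pderiv ^^ k) p"
    using Suc.IH [of "Suc n"] Suc.prems by simp
  then obtain r where "(pderiv ^^ k) p = q ^ Suc n * r"
    by (elim dvdE)
  then show ?case
    by (auto simp: pderiv_mult pderiv_power_Suc simp del: power_Suc
        intro!: dvd_add dvd_smult intro: dvd_mult dvd_mult2 dvd_mult2 [OF le_imp_power_dvd])
qed simp

lemma poly_higher_pderiv_0:
  fixes p :: "'a::{idom,semiring_char_0} poly"
  shows "poly ((pderiv ^^ k) p) 0 = fact k * coeff p k"
  by (simp add: poly_0_coeff_0 coeff_higher_pderiv pochhammer_fact)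

text \<open>The inner function \<open>1 - \<xi>\<close> has derivative \<open>-1\<close>, so each
  derivative contributes one sign.\<close>

lemma higher_pderiv_reflect:
  fixes p :: "'a::idom poly"
  shows "(pderiv ^^ k) (p \<circ>\<^sub>p [:1, -1:]) = smult ((- 1) ^ k) ((pderiv ^^ k) p \<circ>\<^sub>p [:1, -1:])"
  by (induction k) (simp_all add: pderiv_smult pderiv_pcompose pderiv_pCons)

lemma poly_higher_pderiv_hermite_H_0:
  assumes "l \<le> m" "k \<le> m"
  shows "poly ((pderiv ^^ k) (hermite_H m l)) 0 = (if k = l then 1 else 0)"
  using assms by (simp add: poly_higher_pderiv_0 coeff_hermite_H)

lemma poly_higher_pderiv_hermite_H_1:
  assumes "k \<le> m"
  shows "poly ((pderiv ^^ k) (hermite_H m l)) 1 = 0"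
proof -
  \<comment> \<open>The exponent \<open>m + 1\<close> is split so that a factor vanishing at
    \<open>1\<close> survives \<open>k\<close> derivatives.\<close>
  have "[:1, -1:] ^ (Suc (m - k) + k) dvd hermite_H m l"
    using assms by (simp add: hermite_H_def dvd_smult del: power_Suc)
  then have "[:1, -1:] ^ Suc (m - k) dvd (pderiv ^^ k) (hermite_H m l)"
    by (rule power_dvd_higher_pderiv)
  then show ?thesis
    by (auto elim!: dvdE)
qed

text \<open>The sign is \<open>1\<close> for \<open>k = l\<close>; at the endpoints, for other
  \<open>k \<le> m\<close>, it multiplies zero.\<close>

lemma poly_higher_pderiv_hermite_I:
  "poly ((pderiv ^^ k) (hermite_I m l)) x =
     (- 1) ^ (l + k) * poly ((pderiv ^^ k) (hermite_H m l)) (1 - x)"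
  by (simp add: hermite_I_def higher_pderiv_smult higher_pderiv_reflect poly_pcompose power_add)

theorem theorem2p1:
  fixes m l :: nat
  assumes "l \<le> m"
  shows "(\<forall>k \<le> m. poly ((pderiv ^^ k) (hermite_H m l)) 1 = 0
                \<and> poly ((pderiv ^^ k) (hermite_I m l)) 0 = 0)
       \<and> (\<forall>k \<le> m. poly ((pderiv ^^ k) (hermite_H m l)) 0 = (if k = l then 1 else 0)
                \<and> poly ((pderiv ^^ k) (hermite_I m l)) 1 = (if k = l then 1 else 0))"
  using assms
  by (simp add: poly_higher_pderiv_hermite_I poly_higher_pderiv_hermite_H_0
      poly_higher_pderiv_hermite_H_1)

end
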